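(* Let $G$ be a real $2\times 2$ matrix whose four elements are finite, non-zero values of the working floating-point datatype, and let $\underline{R}$ be the upper triangular matrix computed from $G$ by the procedure described in the context, $R$ being its exact counterpart. Assume that no underflow occurs at any stage of the computation leading from $G$ to $\underline{R}$. Then $\underline{r_{11}}=\delta_0 r_{11}$, where $$1-\varepsilon\le\delta_0\le 1+\varepsilon.$$ If $\underline{\tan\vartheta}$ is exact (i.e. $\underline{\tan\vartheta}=\tan\vartheta$), then $\underline{r_{12}}=\delta_1' r_{12}$ and $\underline{r_{22}}=\delta_1'' r_{22}$, where $$\frac{(1-\varepsilon)^2}{\sqrt{((1+\varepsilon)^2+1)/2}\,(1+\varepsilon)}\le\delta_1',\delta_1''\le\frac{(1+\varepsilon)^2}{\sqrt{((1-\varepsilon)^2+1)/2}\,(1-\varepsilon)}.$$ Else, if $\underline{g_{12}'''}$ and $\underline{g_{22}'''}$ are of the same sign, then $\underline{r_{12}}=\delta_2' r_{12}$ and $\underline{r_{22}}=\delta_3' r_{22}$; if they are of opposite signs, then $\underline{r_{22}}=\delta_2'' r_{22}$ and $\underline{r_{12}}=\delta_3'' r_{12}$. Here $$\frac{(1-\varepsilon)^3}{\sqrt{((1+\varepsilon)^2+1)/2}\,(1+\varepsilon)}<\delta_2',\delta_2''<\frac{(1+\varepsilon)^3}{\sqrt{((1-\varepsilon)^2+1)/2}\,(1-\varepsilon)},$$ and $$\frac{(1-\varepsilon_{T})(1-\varepsilon)^2}{\sqrt{((1+\varepsilon)^2+1)/2}\,(1+\varepsilon)}\le\delta_3',\d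elta_3''\le\frac{(1+\varepsilon_{T})(1+\varepsilon)^2}{\sqrt{((1-\varepsilon)^2+1)/2}\,(1-\varepsilon)}.$$
   Context: **Floating-point arithmetic.** The working datatype is a standard IEEE 754 radix-two datatype, single ($p=24$) or double ($p=53$) precision, with $p$ significand bits, subnormal numbers enabled, and $\varepsilon=2^{-p}$. $\mu=2^{e_\mu}$ and $\nu$ are the smallest and the largest positive finite normal values ($e_\mu=-126$ or $-1022$), and $e_\nu=\lfloor\log_2\nu\rfloor$ ($127$ or $1023$). $\mathrm{fl}(x)$ is $x$ rounded to nearest (ties to even) in the working datatype. $\mathrm{fma}(a,b,c)=\mathrm{fl}(a\cdot b+c)$ and $\mathrm{hypot}(a,b)=\mathrm{fl}(\sqrt{a^2+b^2})$ are correctly rounded. $T$ is the next wider standard datatype (double for single working precision; quadruple, $p_T=113$, for double working precision), with $p_T$ significand bits and $\varepsilon_T=2^{-p_T}$; $\mathrm{FL}(x)$ is $x$ rounded to nearest in $T$. An operation underflows if its exact result is non-zero and smaller in magnitude than the smallest positive normal value of the datatype to which it is rounded. An underlined expression denotes the computed value of that expression. **Procedure.** 1. Prescaling. Let $e_G=\max_{i,j}\lfloor\log_2|g_{ij}|\rfloor$ and $s=e_\nu-e_G-2$. Put $G'=2^sG$ (computed elementwise as $\mathrm{fl}(2^sg_{ij})$); all elements of the computed matrix are non-zero. 2. Pivoting. Compute the column norms $\underline{w_1}=\mathrm{hypot}(\underline{g_{11}'},\underline{g_{21}'})$ and $\underline{w_2}=\mathrm{hypot}(\underline{g_{12}'},\underline{g_{22}'})$.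 If $\underline{w_1}<\underline{w_2}$, swap the columns and their norms. Let $w_1'$ be the norm of the new first column. Multiply each row by the sign of its (new) first element to get $G''$. If $g_{11}''<g_{21}''$, swap the rows. The result is $G'''$, with $g_{11}'''\ge g_{21}'''>0$. In the absence of underflow $\underline{G'''}=G'''$. The exact and the computed quantities below refer to the same choice of permutations and signs. 3. Exact triangularization. With $\tan\vartheta=g_{21}'''/g_{11}'''$, $0<\vartheta\le\pi/4$, and $\sec\vartheta=\sqrt{\tan^2\vartheta+1}$, let $$r_{11}''=w_1'=\sqrt{(g_{11}''')^2+(g_{21}''')^2},\quad r_{12}''=\frac{g_{12}'''+g_{22}'''\tan\vartheta}{\sec\vartheta},\quad r_{22}''=\frac{g_{22}'''-g_{12}'''\tan\vartheta}{\sec\vartheta}.$$ The second column is multiplied by the sign of $r_{12}''$, and then the second row by the sign of its second element, so that $R$ is upper triangular with $r_{11}=r_{11}''$, $r_{12}=|r_{12}''|$, $r_{22}=|r_{22}''|$. The same sign changes are done on the computed quantities, so $\underline{r_{11}}=\underline{r_{11}''}$, $\underline{r_{12}}=|\underline{r_{12}''}|$, $\underline{r_{22}}=|\underline{r_{22}''}|$. The matrix $\underline{R}$ is formed only when $\underline{r_{12}''}\ne 0$ and $\underline{r_{22}''}\ne 0$ (otherwise the matrix is of a simpler zero pattern and is handled differently). 4. Computed quantities. $\underline{r_{11}''}=\underline{w_1'}$ (the hypot value of the first column), $\underline{\tan\vartheta}=\mathrm{fl}(\underline{g_{21}'''}/\underline{g_{11}'''})$, and $\underline{\sec\vartheta}=\mathrm{hypot}(\underline{\tan\vartheta},1)$.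 By default, $$\underline{r_{12}''}=\mathrm{fl}\bigl(\mathrm{fma}(\underline{g_{22}'''},\underline{\tan\vartheta},\underline{g_{12}'''})/\underline{\sec\vartheta}\bigr),\qquad \underline{r_{22}''}=\mathrm{fl}\bigl(\mathrm{fma}(-\underline{g_{12}'''},\underline{\tan\vartheta},\underline{g_{22}'''})/\underline{\sec\vartheta}\bigr).$$ However, if $\underline{\tan\vartheta}\ne\tan\vartheta$, the one element that involves an essential subtraction, namely $r_{22}''$ if $\underline{g_{12}'''}$ and $\underline{g_{22}'''}$ have the same sign, and $r_{12}''$ if they have opposite signs, is instead computed using the wider datatype $T$ as, respectively, $$\underline{r_{22}''}=\mathrm{fl}\bigl(\mathrm{fl}(\mathrm{FL}(\mathrm{FL}(g_{22}'''g_{11}'''-g_{12}'''g_{21}''')/g_{11}'''))/\underline{\sec\vartheta}\bigr),$$ $$\underline{r_{12}''}=\mathrm{fl}\bigl(\mathrm{fl}(\mathrm{FL}(\mathrm{FL}(g_{12}'''g_{11}'''+g_{22}'''g_{21}''')/g_{11}'''))/\underline{\sec\vartheta}\bigr),$$ where the products are exact in $T$ and the sum or difference of the two products is rounded once by the inner $\mathrm{FL}$. *)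

theory Defs
  imports "HOL-Analysis.Analysis"
begin

section \<open>IEEE 754 binary formats\<close>

datatype fp_format = FP_Format (prec: nat) (emax: int)

definition binary32 :: fp_format where "binary32 = FP_Format 24 127"
definition binary64 :: fp_format where "binary64 = FP_Format 53 1023"
definition binary128 :: fp_format where "binary128 = FP_Format 113 16383"

definition emin :: "fp_format \<Rightarrow> int" where
  "emin F = 1 - emax F"

definition eps :: "fp_format \<Rightarrow> real" where
  "eps F = 2 powi (- int (prec F))"

text \<open>Finite values, zero and the subnormal ones included; the two signed zeros are identified.\<close>

definition fp_values :: "fp_format \<Rightarrow> real set" where
  "fp_values F = {of_int m * 2 powi e | m e.
     \<bar>m\<bar> < 2 ^ prec F \<and> emin F - int (prec F) + 1 \<le> e \<and> e \<le> emax F - int (prec F) + 1}"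

definition min_normal :: "fp_format \<Rightarrow> real" where
  "min_normal F = 2 powi emin F"

definition max_normal :: "fp_format \<Rightarrow> real" where
  "max_normal F = (2 - 2 powi (1 - int (prec F))) * 2 powi emax F"

definition round_half_even :: "real \<Rightarrow> int" where
  "round_half_even x =
     (if frac x < 1/2 \<or> frac x = 1/2 \<and> even \<lfloor>x\<rfloor> then \<lfloor>x\<rfloor> else \<lfloor>x\<rfloor> + 1)"

text \<open>The exponent of the unit in the last place in the binade of \<open>x\<close>, bounded below by the
  exponent of the smallest subnormal value.\<close>

definition ulp_exponent :: "fp_format \<Rightarrow> real \<Rightarrow> int" where
  "ulp_exponent F x = max \<lfloor>log 2 \<bar>x\<bar>\<rfloor> (emin F) - int (prec F) + 1"

text \<open>From the magnitude \<open>(2 - eps F) * 2 powi emax F\<close> on, rounding to nearest results in an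
  infinity; as there is no such real number, the value is then left unspecified, so that nothing
  can be concluded from a computation that overflows.\<close>

definition fl :: "fp_format \<Rightarrow> real \<Rightarrow> real" where
  "fl F x =
     (if x = 0 then 0
      else if \<bar>x\<bar> < (2 - eps F) * 2 powi emax F
      then of_int (round_half_even (x / 2 powi ulp_exponent F x)) * 2 powi ulp_exponent F x
      else undefined)"

definition fma :: "fp_format \<Rightarrow> real \<Rightarrow> real \<Rightarrow> real \<Rightarrow> real" where
  "fma F a b c = fl F (a * b + c)"

definition hypot :: "fp_format \<Rightarrow> real \<Rightarrow> real \<Rightarrow> real" where
  "hypot F a b = fl F (sqrt (a\<^sup>2 + b\<^sup>2))"

text \<open>Here \<open>x\<close> is the exact result of an operation that is rounded to the format \<open>F\<close>.\<close>

definition underflows :: "fp_format \<Rightarrow> real \<Rightarrow> bool" where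
  "underflows F x \<longleftrightarrow> x \<noteq> 0 \<and> \<bar>x\<bar> < min_normal F"


section \<open>Prescaling and pivoting\<close>

text \<open>Below, \<open>W\<close> is the working format and \<open>T\<close> the wider one. The suffix \<open>_fp\<close> marks the
  computed (underlined) quantities, as opposed to the exact ones.\<close>

definition mat2 :: "real \<Rightarrow> real \<Rightarrow> real \<Rightarrow> real \<Rightarrow> real^2^2" where
  "mat2 a b c d = vector [vector [a, b], vector [c, d]]"

definition scale_exponent :: "fp_format \<Rightarrow> real^2^2 \<Rightarrow> int" where
  "scale_exponent W G =
     \<lfloor>log 2 (max_normal W)\<rfloor> - Max {\<lfloor>log 2 \<bar>G $ i $ j\<bar>\<rfloor> | i j. True} - 2"

definition scaled :: "fp_format \<Rightarrow> real^2^2 \<Rightarrow> real^2^2" where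
  "scaled W G = (\<chi> i j. 2 powi scale_exponent W G * G $ i $ j)"

definition scaled_fp :: "fp_format \<Rightarrow> real^2^2 \<Rightarrow> real^2^2" where
  "scaled_fp W G = (\<chi> i j. fl W (2 powi scale_exponent W G * G $ i $ j))"

definition column_norm_fp :: "fp_format \<Rightarrow> real^2^2 \<Rightarrow> 2 \<Rightarrow> real" where
  "column_norm_fp W C j = hypot W (C $ 1 $ j) (C $ 2 $ j)"

definition swaps_columns :: "fp_format \<Rightarrow> real^2^2 \<Rightarrow> bool" where
  "swaps_columns W C \<longleftrightarrow> column_norm_fp W C 1 < column_norm_fp W C 2"

definition swap_columns :: "real^2^2 \<Rightarrow> real^2^2" where
  "swap_columns M = mat2 (M $ 1 $ 2) (M $ 1 $ 1) (M $ 2 $ 2) (M $ 2 $ 1)"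

definition swap_rows :: "real^2^2 \<Rightarrow> real^2^2" where
  "swap_rows M = mat2 (M $ 2 $ 1) (M $ 2 $ 2) (M $ 1 $ 1) (M $ 1 $ 2)"

text \<open>Applies to \<open>M\<close> the permutations and signs that the pivoting chooses for the computed
  matrix \<open>C\<close>; the exact and the computed matrices thus undergo the same transformations.\<close>

definition pivot :: "fp_format \<Rightarrow> real^2^2 \<Rightarrow> real^2^2 \<Rightarrow> real^2^2" where
  "pivot W C M =
     (let cols = (\<lambda>A. if swaps_columns W C then swap_columns A else A);
          signs = (\<lambda>A. \<chi> i j. sgn (cols C $ i $ 1) * cols A $ i $ j);
          rows = (\<lambda>A. if signs C $ 1 $ 1 < signs C $ 2 $ 1 then swap_rows A else A)
      in rows (signs M))"

definition pivoted :: "fp_format \<Rightarrow> real^2^2 \<Rightarrow> real^2^2" where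
  "pivoted W G = pivot W (scaled_fp W G) (scaled W G)"

definition pivoted_fp :: "fp_format \<Rightarrow> real^2^2 \<Rightarrow> real^2^2" where
  "pivoted_fp W G = pivot W (scaled_fp W G) (scaled_fp W G)"


section \<open>The exact triangular factor\<close>

definition tan_theta :: "fp_format \<Rightarrow> real^2^2 \<Rightarrow> real" where
  "tan_theta W G = pivoted W G $ 2 $ 1 / pivoted W G $ 1 $ 1"

definition sec_theta :: "fp_format \<Rightarrow> real^2^2 \<Rightarrow> real" where
  "sec_theta W G = sqrt ((tan_theta W G)\<^sup>2 + 1)"

definition r11'' :: "fp_format \<Rightarrow> real^2^2 \<Rightarrow> real" where
  "r11'' W G = sqrt ((pivoted W G $ 1 $ 1)\<^sup>2 + (pivoted W G $ 2 $ 1)\<^sup>2)"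

definition r12'' :: "fp_format \<Rightarrow> real^2^2 \<Rightarrow> real" where
  "r12'' W G =
     (pivoted W G $ 1 $ 2 + pivoted W G $ 2 $ 2 * tan_theta W G) / sec_theta W G"

definition r22'' :: "fp_format \<Rightarrow> real^2^2 \<Rightarrow> real" where
  "r22'' W G =
     (pivoted W G $ 2 $ 2 - pivoted W G $ 1 $ 2 * tan_theta W G) / sec_theta W G"

definition R_exact :: "fp_format \<Rightarrow> real^2^2 \<Rightarrow> real^2^2" where
  "R_exact W G = mat2 (r11'' W G) \<bar>r12'' W G\<bar> 0 \<bar>r22'' W G\<bar>"


section \<open>The computed triangular factor\<close>

definition tan_fp :: "fp_format \<Rightarrow> real^2^2 \<Rightarrow> real" where
  "tan_fp W G = fl W (pivoted_fp W G $ 2 $ 1 / pivoted_fp W G $ 1 $ 1)"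

definition sec_fp :: "fp_format \<Rightarrow> real^2^2 \<Rightarrow> real" where
  "sec_fp W G = hypot W (tan_fp W G) 1"

definition tan_exact :: "fp_format \<Rightarrow> real^2^2 \<Rightarrow> bool" where
  "tan_exact W G \<longleftrightarrow> tan_fp W G = tan_theta W G"

definition same_signs :: "fp_format \<Rightarrow> real^2^2 \<Rightarrow> bool" where
  "same_signs W G \<longleftrightarrow> sgn (pivoted_fp W G $ 1 $ 2) = sgn (pivoted_fp W G $ 2 $ 2)"

definition opposite_signs :: "fp_format \<Rightarrow> real^2^2 \<Rightarrow> bool" where
  "opposite_signs W G \<longleftrightarrow> sgn (pivoted_fp W G $ 1 $ 2) = - sgn (pivoted_fp W G $ 2 $ 2)"

definition wide_quotient :: "fp_format \<Rightarrow> fp_format \<Rightarrow> real \<Rightarrow> real \<Rightarrow> real" where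
  "wide_quotient W T d g = fl W (fl T (fl T d / g))"

definition wide_quotient_underflows ::
    "fp_format \<Rightarrow> fp_format \<Rightarrow> real \<Rightarrow> real \<Rightarrow> bool" where
  "wide_quotient_underflows W T d g \<longleftrightarrow>
     underflows T d \<or> underflows T (fl T d / g) \<or> underflows W (fl T (fl T d / g))"

definition numerator12_fp :: "fp_format \<Rightarrow> fp_format \<Rightarrow> real^2^2 \<Rightarrow> real" where
  "numerator12_fp W T G =
     (let H = pivoted_fp W G in
      if \<not> tan_exact W G \<and> opposite_signs W G
      then wide_quotient W T (H $ 1 $ 2 * H $ 1 $ 1 + H $ 2 $ 2 * H $ 2 $ 1) (H $ 1 $ 1)
      else fma W (H $ 2 $ 2) (tan_fp W G) (H $ 1 $ 2))"

definition numerator12_underflows :: "fp_format \<Rightarrow> fp_format \<Rightarrow> real^2^2 \<Rightarrow> bool" where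
  "numerator12_underflows W T G \<longleftrightarrow>
     (let H = pivoted_fp W G in
      if \<not> tan_exact W G \<and> opposite_signs W G
      then wide_quotient_underflows W T
             (H $ 1 $ 2 * H $ 1 $ 1 + H $ 2 $ 2 * H $ 2 $ 1) (H $ 1 $ 1)
      else underflows W (H $ 2 $ 2 * tan_fp W G + H $ 1 $ 2))"

definition numerator22_fp :: "fp_format \<Rightarrow> fp_format \<Rightarrow> real^2^2 \<Rightarrow> real" where
  "numerator22_fp W T G =
     (let H = pivoted_fp W G in
      if \<not> tan_exact W G \<and> same_signs W G
      then wide_quotient W T (H $ 2 $ 2 * H $ 1 $ 1 - H $ 1 $ 2 * H $ 2 $ 1) (H $ 1 $ 1)
      else fma W (- H $ 1 $ 2) (tan_fp W G) (H $ 2 $ 2))"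

definition numerator22_underflows :: "fp_format \<Rightarrow> fp_format \<Rightarrow> real^2^2 \<Rightarrow> bool" where
  "numerator22_underflows W T G \<longleftrightarrow>
     (let H = pivoted_fp W G in
      if \<not> tan_exact W G \<and> same_signs W G
      then wide_quotient_underflows W T
             (H $ 2 $ 2 * H $ 1 $ 1 - H $ 1 $ 2 * H $ 2 $ 1) (H $ 1 $ 1)
      else underflows W (- H $ 1 $ 2 * tan_fp W G + H $ 2 $ 2))"

definition r11''_fp :: "fp_format \<Rightarrow> real^2^2 \<Rightarrow> real" where
  "r11''_fp W G =
     column_norm_fp W (scaled_fp W G) (if swaps_columns W (scaled_fp W G) then 2 else 1)"

definition r12''_fp :: "fp_format \<Rightarrow> fp_format \<Rightarrow> real^2^2 \<Rightarrow> real" where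
  "r12''_fp W T G = fl W (numerator12_fp W T G / sec_fp W G)"

definition r22''_fp :: "fp_format \<Rightarrow> fp_format \<Rightarrow> real^2^2 \<Rightarrow> real" where
  "r22''_fp W T G = fl W (numerator22_fp W T G / sec_fp W G)"

definition R_fp :: "fp_format \<Rightarrow> fp_format \<Rightarrow> real^2^2 \<Rightarrow> real^2^2" where
  "R_fp W T G = mat2 (r11''_fp W G) \<bar>r12''_fp W T G\<bar> 0 \<bar>r22''_fp W T G\<bar>"

definition R_fp_formed :: "fp_format \<Rightarrow> fp_format \<Rightarrow> real^2^2 \<Rightarrow> bool" where
  "R_fp_formed W T G \<longleftrightarrow> r12''_fp W T G \<noteq> 0 \<and> r22''_fp W T G \<noteq> 0"

text \<open>Permutations and sign changes are exact and hence absent from the list of operations. The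
  products inside the wide numerators are not rounded separately.\<close>

definition no_underflow :: "fp_format \<Rightarrow> fp_format \<Rightarrow> real^2^2 \<Rightarrow> bool" where
  "no_underflow W T G \<longleftrightarrow>
     (let C = scaled_fp W G; H = pivoted_fp W G in
      (\<forall>i j. \<not> underflows W (2 powi scale_exponent W G * G $ i $ j)) \<and>
      (\<forall>j. \<not> underflows W (sqrt ((C $ 1 $ j)\<^sup>2 + (C $ 2 $ j)\<^sup>2))) \<and>
      \<not> underflows W (H $ 2 $ 1 / H $ 1 $ 1) \<and>
      \<not> underflows W (sqrt ((tan_fp W G)\<^sup>2 + 1\<^sup>2)) \<and>
      \<not> numerator12_underflows W T G \<and>
      \<not> numerator22_underflows W T G \<and>
      \<not> underflows W (numerator12_fp W T G / sec_fp W G) \<and>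
      \<not> underflows W (numerator22_fp W T G / sec_fp W G))"

end

theory Submission
  imports Defs
begin

text \<open>Write \<open>u\<close> for the unit roundoff of the working format and \<open>u\<^sub>T\<close> for that of the wider one.
  In the absence of underflow and overflow, every rounding multiplies its exact argument by a factor
  close to one, so that the relative error of a computed element is a quotient of such factors. What
  remains is to see that no operation overflows, and how the error of the computed tangent propagates.

  The scaling is by a power of two and hence exact (\<open>scaled_fp_exact\<close>), so that the exact and the
  computed pivoted matrices are equal. It brings all elements below half of \<open>\<Omega>\<close>, the largest power
  of two in the working format. As the tangent \<open>t\<close> is at most one, everything that is rounded to
  this format later has a magnitude of at most about \<open>\<Omega>\<close>, while the overflow threshold is almost
  \<open>2 * \<Omega>\<close>; and the wider format has room for the magnitude \<open>\<Omega>\<^sup>2\<close> of the products.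

  Let the computed tangent be \<open>k * t\<close>. The secant changes by at most the factor that is attained at
  \<open>t = 1\<close> (\<open>secant_perturbation\<close>); this is where the square roots in the bounds come from. The
  numerators have the form \<open>x + y * t\<close>. If \<open>x\<close> and \<open>y\<close> have the same sign, then replacing \<open>t\<close> by
  \<open>k * t\<close> changes the sum by a factor between \<open>1\<close> and \<open>k\<close> (\<open>sum_perturbation\<close>), which costs one
  more factor \<open>1 \<plusminus> u\<close> (\<open>entry_same_signs\<close>). If the signs differ, the error of the tangent could be
  amplified without bound by cancellation; the wide computation avoids it, as it uses the
  elements of the first column instead of the tangent (\<open>entry_wide\<close>).

  The wide computation rounds twice to the wider format and twice to the working format, but the bounds
  contain \<open>1 \<plusminus> u\<^sub>T\<close> only once. The second such factor is absorbed by the slack in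
  the bound for the working format: the relative error of rounding to nearest is at most
  \<open>u / (1 + u)\<close>, not only \<open>u\<close> (\<open>fl_relative_error\<close>), and the difference of about \<open>u\<^sup>2\<close> exceeds
  \<open>u\<^sub>T\<close> for both pairs of formats (\<open>double_rounding_slack\<close>).\<close>

section \<open>Rounding to nearest\<close>

lemma exponent_bounds:
  fixes x :: real
  assumes "x \<noteq> 0"
  shows "2 powi \<lfloor>log 2 \<bar>x\<bar>\<rfloor> \<le> \<bar>x\<bar>" "\<bar>x\<bar> < 2 * 2 powi \<lfloor>log 2 \<bar>x\<bar>\<rfloor>"
proof -
  have "2 powr \<lfloor>log 2 \<bar>x\<bar>\<rfloor> \<le> \<bar>x\<bar> \<and> \<bar>x\<bar> < 2 powr (\<lfloor>log 2 \<bar>x\<bar>\<rfloor> + 1)"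
    using floor_log_eq_powr_iff[of "\<bar>x\<bar>" 2 "\<lfloor>log 2 \<bar>x\<bar>\<rfloor>"] assms by simp
  moreover have "2 powr (\<lfloor>log 2 \<bar>x\<bar>\<rfloor> + 1) = (2 :: real) * 2 powi \<lfloor>log 2 \<bar>x\<bar>\<rfloor>"
    using powr_real_of_int'[of 2 "\<lfloor>log 2 \<bar>x\<bar>\<rfloor>"] by (simp add: powr_add)
  ultimately show "2 powi \<lfloor>log 2 \<bar>x\<bar>\<rfloor> \<le> \<bar>x\<bar>" "\<bar>x\<bar> < 2 * 2 powi \<lfloor>log 2 \<bar>x\<bar>\<rfloor>"
    using powr_real_of_int'[of 2 "\<lfloor>log 2 \<bar>x\<bar>\<rfloor>"] by simp_all
qed

lemma exponent_eqI:
  fixes x :: real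
  assumes "2 powi k \<le> x" "x < 2 * 2 powi k"
  shows "\<lfloor>log 2 x\<rfloor> = k"
proof -
  have "x > 0" using assms(1) zero_less_power_int[of "2::real" k] by linarith
  then show ?thesis
    using assms powr_real_of_int'[of 2 k]
    by (subst floor_log_eq_powr_iff) (simp_all add: powr_add)
qed

lemma exponent_lessI: "m < n" if "(2 :: real) powi m < 2 powi n"
  using power_int_increasing[of n m "2 :: real"] that by (meson linorder_not_less one_le_numeral)

lemma round_half_even_nearest:
  "\<bar>of_int (round_half_even x) - x\<bar> \<le> \<bar>of_int n - x\<bar>"
proof (cases "n \<le> \<lfloor>x\<rfloor>")
  case True
  then have "real_of_int n \<le> of_int \<lfloor>x\<rfloor>" by simp
  then show ?thesis
    by (auto simp: round_half_even_def frac_def abs_if; linarith)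
next
  case False
  then have "real_of_int n \<ge> of_int \<lfloor>x\<rfloor> + 1" by linarith
  then show ?thesis
    by (auto simp: round_half_even_def frac_def abs_if; linarith)
qed

lemma round_half_even_error: "\<bar>of_int (round_half_even x) - x\<bar> \<le> 1 / 2"
  using round_half_even_nearest[of x "round x"] of_int_round_abs_le[of x] by linarith

lemma ulp_exponent_normal:
  assumes "x \<noteq> 0" "\<not> underflows F x"
  shows "ulp_exponent F x = \<lfloor>log 2 \<bar>x\<bar>\<rfloor> - int (prec F) + 1"
proof -
  have "2 powi emin F \<le> \<bar>x\<bar>"
    using assms by (simp add: underflows_def min_normal_def)
  also have "\<dots> < 2 powi (\<lfloor>log 2 \<bar>x\<bar>\<rfloor> + 1)"
    using exponent_bounds(2)[OF assms(1)] by (simp add: power_int_add)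
  finally have "emin F < \<lfloor>log 2 \<bar>x\<bar>\<rfloor> + 1"
    by (rule exponent_lessI)
  then show ?thesis by (simp add: ulp_exponent_def)
qed

text \<open>For \<open>2 powi k \<le> \<bar>x\<bar> < 2 powi (k + 1)\<close>, the error is at most half a unit in the last
  place, that is, \<open>eps F * 2 powi k\<close>. Relative to \<open>\<bar>x\<bar>\<close>, this bound is weakest near the left end of the
  binade, but there the error is also bounded by the distance to \<open>2 powi k\<close>. The two estimates meet at
  \<open>\<bar>x\<bar> = (1 + eps F) * 2 powi k\<close>, which leads to the relative error \<open>eps F / (1 + eps F)\<close>. Since this is
  strictly less than \<open>eps F\<close>, it also yields the strict bounds and the slack needed later.\<close>
lemma fl_relative_error:
  assumes prec: "prec F \<ge> 1"
    and normal: "\<not> underflows F x"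
    and range: "\<bar>x\<bar> < (2 - eps F) * 2 powi emax F"
  obtains q where "fl F x = q * x" "1 / (1 + eps F) \<le> q" "q \<le> (1 + 2 * eps F) / (1 + eps F)"
proof (cases "x = 0")
  case True
  have "eps F > 0" by (simp add: eps_def)
  with True that[of 1] show ?thesis by (simp add: fl_def field_simps)
next
  case False
  define k where "k = \<lfloor>log 2 \<bar>x\<bar>\<rfloor>"
  define ulp :: real where "ulp = 2 powi (k - int (prec F) + 1)"
  have eps0: "eps F > 0" by (simp add: eps_def)
  have ulp0: "ulp > 0" by (simp add: ulp_def)
  have half_ulp: "ulp / 2 = eps F * 2 powi k"
    by (simp add: ulp_def eps_def power_int_add power_int_diff power_int_minus field_simps)
  have lower: "2 powi k \<le> \<bar>x\<bar>" using exponent_bounds(1)[OF False] by (simp add: k_def)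
  have fl: "fl F x = of_int (round_half_even (x / ulp)) * ulp"
    using False range normal ulp_exponent_normal[OF False normal]
    by (simp add: fl_def ulp_def k_def)
  have dist: "\<bar>fl F x - x\<bar> = \<bar>of_int (round_half_even (x / ulp)) - x / ulp\<bar> * ulp"
  proof -
    have "fl F x - x = (of_int (round_half_even (x / ulp)) - x / ulp) * ulp"
      using ulp0 by (simp add: fl field_simps)
    then show ?thesis using ulp0 by (simp add: abs_mult)
  qed
  have nearest: "\<bar>fl F x - x\<bar> \<le> \<bar>of_int n * ulp - x\<bar>" for n
  proof -
    have "\<bar>fl F x - x\<bar> \<le> \<bar>of_int n - x / ulp\<bar> * ulp"
      using round_half_even_nearest[of "x / ulp" n] ulp0 by (simp add: dist)
    also have "\<dots> = \<bar>(of_int n - x / ulp) * ulp\<bar>" using ulp0 by (simp add: abs_mult)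
    also have "(of_int n - x / ulp) * ulp = of_int n * ulp - x" using ulp0 by (simp add: field_simps)
    finally show ?thesis .
  qed
  have "\<bar>fl F x - x\<bar> \<le> (1 / 2) * ulp"
    unfolding dist using round_half_even_error[of "x / ulp"] ulp0 by (intro mult_right_mono) auto
  then have half: "\<bar>fl F x - x\<bar> \<le> eps F * 2 powi k" using half_ulp by simp
  have error: "\<bar>fl F x - x\<bar> \<le> eps F / (1 + eps F) * \<bar>x\<bar>"
  proof (cases "\<bar>x\<bar> \<ge> (1 + eps F) * 2 powi k")
    case True
    have "eps F * 2 powi k = eps F / (1 + eps F) * ((1 + eps F) * 2 powi k)"
      using eps0 by simp
    also have "\<dots> \<le> eps F / (1 + eps F) * \<bar>x\<bar>"
      using True eps0 by (intro mult_left_mono) auto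
    finally show ?thesis using half by linarith
  next
    case close: False
    \<comment> \<open>The power of two below \<open>x\<close> is a multiple of the unit in the last place.\<close>
    define n where "n = (if x > 0 then 1 else - 1) * (2 :: int) ^ (prec F - 1)"
    have "2 powi k = 2 ^ (prec F - 1) * ulp"
    proof -
      have "2 powi k = (2 :: real) powi (int (prec F - 1) + (k - int (prec F) + 1))"
        using prec by (simp add: of_nat_diff)
      then show ?thesis unfolding ulp_def by (subst (asm) power_int_add) simp_all
    qed
    then have "of_int n * ulp = (if x > 0 then 1 else - 1) * 2 powi k"
      by (simp add: n_def)
    then have "\<bar>of_int n * ulp - x\<bar> = \<bar>x\<bar> - 2 powi k"
      using lower False by (auto simp: abs_if split: if_splits)
    with nearest[of n] have "\<bar>fl F x - x\<bar> \<le> \<bar>x\<bar> - 2 powi k" by simp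
    also have "\<dots> \<le> eps F / (1 + eps F) * \<bar>x\<bar>"
      using close eps0 by (simp add: field_simps)
    finally show ?thesis .
  qed
  define q where "q = fl F x / x"
  have "fl F x = q * x" using False by (simp add: q_def)
  moreover have "\<bar>q - 1\<bar> \<le> eps F / (1 + eps F)"
  proof -
    have "\<bar>q - 1\<bar> = \<bar>fl F x - x\<bar> / \<bar>x\<bar>"
      using False by (simp add: q_def flip: abs_divide) (simp add: field_simps)
    then show ?thesis using error False by (simp add: pos_divide_le_eq)
  qed
  moreover have "1 - eps F / (1 + eps F) = 1 / (1 + eps F)"
    "1 + eps F / (1 + eps F) = (1 + 2 * eps F) / (1 + eps F)"
    using eps0 by (simp_all add: field_simps)
  ultimately show ?thesis using that[of q] by linarith
qed

text \<open>In the normal range, the unit in the last place of \<open>x\<close> is at most \<open>2 powi e\<close>, because the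
  leading bit of \<open>m\<close> has one of the \<open>prec F\<close> lowest positions; hence \<open>x\<close> is a multiple of that unit.\<close>
lemma fl_exact:
  assumes x: "x = of_int m * 2 powi e" and m: "\<bar>m\<bar> < 2 ^ prec F"
    and normal: "\<not> underflows F x"
    and range: "\<bar>x\<bar> < (2 - eps F) * 2 powi emax F"
  shows "fl F x = x"
proof (cases "x = 0")
  case True
  then show ?thesis by (simp add: fl_def)
next
  case False
  define k where "k = \<lfloor>log 2 \<bar>x\<bar>\<rfloor>"
  define ulp :: real where "ulp = 2 powi (k - int (prec F) + 1)"
  have fl: "fl F x = of_int (round_half_even (x / ulp)) * ulp"
    using False range normal ulp_exponent_normal[OF False normal]
    by (simp add: fl_def ulp_def k_def)
  have "2 powi k \<le> \<bar>of_int m :: real\<bar> * 2 powi e"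
    using exponent_bounds(1)[OF False] by (simp add: k_def x abs_mult)
  also have "\<dots> < 2 ^ prec F * 2 powi e"
  proof (rule mult_strict_right_mono)
    have "real_of_int \<bar>m\<bar> < of_int (2 ^ prec F)" using m by (simp only: of_int_less_iff)
    then show "\<bar>of_int m :: real\<bar> < 2 ^ prec F" by simp
  qed simp
  also have "\<dots> = 2 powi (int (prec F) + e)" by (simp add: power_int_add)
  finally have "k < int (prec F) + e"
    by (rule exponent_lessI)
  then obtain j where j: "e = (k - int (prec F) + 1) + int j"
    by (metis add.commute zle_iff_zadd zless_imp_add1_zle diff_add_eq diff_le_eq)
  have "x / ulp = of_int (m * 2 ^ j)"
    unfolding x j ulp_def by (subst power_int_add) simp_all
  moreover have "round_half_even (of_int n) = n" for n
    by (simp add: round_half_even_def)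
  ultimately have "of_int (round_half_even (x / ulp)) = x / ulp" by (simp only:)
  then show ?thesis by (simp add: fl ulp_def)
qed

section \<open>Scaling and pivoting\<close>

lemma floor_log_max_normal:
  assumes "prec F \<ge> 1"
  shows "\<lfloor>log 2 (max_normal F)\<rfloor> = emax F"
proof (rule exponent_eqI)
  have "(2 :: real) powi (1 - int (prec F)) \<le> 2 powi 0"
    using assms by (intro power_int_increasing) simp_all
  then have "1 * 2 powi emax F \<le> (2 - 2 powi (1 - int (prec F))) * (2 :: real) powi emax F"
    by (intro mult_right_mono) simp_all
  then show "2 powi emax F \<le> max_normal F" by (simp add: max_normal_def)
  show "max_normal F < 2 * 2 powi emax F" by (simp add: max_normal_def)
qed

text \<open>The \<open>2\<close> subtracted in the scaling exponent puts the largest element two binades below the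
  top one, so that sums of two elements and norms of columns cannot overflow.\<close>
lemma scaled_magnitude:
  assumes "prec W \<ge> 1" "\<And>i j. G $ i $ j \<noteq> 0"
  shows "\<bar>scaled W G $ i $ j\<bar> < 2 powi emax W / 2"
proof -
  let ?S = "{\<lfloor>log 2 \<bar>G $ i $ j\<bar>\<rfloor> | i j. True}"
  have "?S = (\<lambda>(i, j). \<lfloor>log 2 \<bar>G $ i $ j\<bar>\<rfloor>) ` UNIV" by auto
  then have "finite ?S" by simp
  then have le: "\<lfloor>log 2 \<bar>G $ i $ j\<bar>\<rfloor> \<le> Max ?S" by (rule Max_ge) blast
  have "\<bar>G $ i $ j\<bar> < 2 * 2 powi \<lfloor>log 2 \<bar>G $ i $ j\<bar>\<rfloor>"
    by (rule exponent_bounds(2)[OF assms(2)])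
  also have "\<dots> \<le> 2 * 2 powi Max ?S"
    using le by (intro mult_left_mono power_int_increasing) simp_all
  finally have "2 powi scale_exponent W G * \<bar>G $ i $ j\<bar>
      < 2 powi scale_exponent W G * (2 * 2 powi Max ?S)"
    by (rule mult_strict_left_mono) simp
  also have "\<dots> = 2 powi emax W / 2"
    by (simp add: scale_exponent_def floor_log_max_normal[OF assms(1)] power_int_diff)
  finally show ?thesis by (simp add: scaled_def abs_mult)
qed

lemma eps_le_half: "eps F \<le> 1 / 2" if "prec F \<ge> 1"
proof -
  have "eps F \<le> 2 powi (-1)"
    unfolding eps_def using that by (intro power_int_increasing) simp_all
  then show ?thesis by (simp add: power_int_minus)
qed

lemma scaled_fp_exact:
  assumes prec: "prec W \<ge> 1"
    and G: "\<And>i j. G $ i $ j \<in> fp_values W" "\<And>i j. G $ i $ j \<noteq> 0"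
    and normal: "\<And>i j. \<not> underflows W (2 powi scale_exponent W G * G $ i $ j)"
  shows "scaled_fp W G = scaled W G"
proof -
  have "fl W (2 powi scale_exponent W G * G $ i $ j) = 2 powi scale_exponent W G * G $ i $ j"
    for i j
  proof -
    obtain m e where g: "G $ i $ j = of_int m * 2 powi e" and m: "\<bar>m\<bar> < 2 ^ prec W"
      using G(1)[of i j] by (auto simp: fp_values_def)
    have "\<bar>2 powi scale_exponent W G * G $ i $ j\<bar> < (1 / 2) * 2 powi emax W"
      using scaled_magnitude[OF prec G(2), of i j] by (simp add: scaled_def)
    also have "\<dots> \<le> (2 - eps W) * 2 powi emax W"
      using eps_le_half[OF prec] by (intro mult_right_mono) simp_all
    finally have range: "\<bar>2 powi scale_exponent W G * G $ i $ j\<bar> < (2 - eps W) * 2 powi emax W" .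
    have "2 powi scale_exponent W G * G $ i $ j = of_int m * 2 powi (scale_exponent W G + e)"
      by (simp add: g power_int_add)
    then show ?thesis using m normal range by (rule fl_exact)
  qed
  then show ?thesis by (simp add: scaled_fp_def scaled_def)
qed

text \<open>The pivoting only permutes and changes signs, which affects neither the norm of the chosen
  column nor, below, the magnitudes of the elements; the signs of the rows make its first column
  positive, and swapping the rows orders it.\<close>
lemma pivot_first_column:
  assumes "\<And>i j. C $ i $ j \<noteq> 0"
  shows "0 < pivot W C C $ 2 $ 1" "pivot W C C $ 2 $ 1 \<le> pivot W C C $ 1 $ 1"
    "(pivot W C C $ 1 $ 1)\<^sup>2 + (pivot W C C $ 2 $ 1)\<^sup>2 =
       (C $ 1 $ (if swaps_columns W C then 2 else 1))\<^sup>2 +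
       (C $ 2 $ (if swaps_columns W C then 2 else 1))\<^sup>2"
  using assms
  by (auto simp: pivot_def Let_def swap_columns_def swap_rows_def mat2_def abs_sgn[symmetric]
      mult.commute[of "sgn _"])

lemma pivot_nonzero:
  assumes "\<And>i j. C $ i $ j \<noteq> 0"
  shows "pivot W C C $ i $ j \<noteq> 0"
proof -
  have "\<forall>i j. pivot W C C $ i $ j \<noteq> 0"
    using assms
    by (simp add: pivot_def Let_def swap_columns_def swap_rows_def mat2_def forall_2 sgn_eq_0_iff)
  then show ?thesis by blast
qed

lemma pivot_magnitude:
  assumes "\<And>i j. C $ i $ j \<noteq> 0" "\<And>i j. \<bar>C $ i $ j\<bar> < B"
  shows "\<bar>pivot W C C $ i $ j\<bar> < B"
proof -
  have "\<forall>i j. \<bar>pivot W C C $ i $ j\<bar> < B"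
    using assms
    by (simp add: pivot_def Let_def swap_columns_def swap_rows_def mat2_def forall_2 abs_mult abs_sgn_eq)
  then show ?thesis by blast
qed

section \<open>Perturbation of the tangent\<close>

text \<open>Without cancellation, \<open>z\<close> contributes to the sum a fraction \<open>w\<close> between \<open>0\<close> and \<open>1\<close>, so
  that the factor \<open>k'\<close> is the convex combination \<open>(1 - w) * 1 + w * k\<close>.\<close>
lemma sum_perturbation:
  fixes x z :: real
  assumes "x * z \<ge> 0"
  obtains k' where "x + k * z = k' * (x + z)" "min 1 k \<le> k'" "k' \<le> max 1 k"
proof (cases "x + z = 0")
  case True
  then have "x = - z" by simp
  with assms have "z = 0" by (auto simp: mult_le_0_iff)
  with \<open>x = - z\<close> that[of 1] show ?thesis by simp
next
  case False
  define w where "w = z / (x + z)"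
  have w: "0 \<le> w" "w \<le> 1"
    using assms False by (auto simp: w_def field_simps zero_le_mult_iff split: if_splits)
  have "x + k * z = (1 + (k - 1) * w) * (x + z)"
    using False by (simp add: w_def field_simps)
  moreover have "min 1 k \<le> 1 + (k - 1) * w" "1 + (k - 1) * w \<le> max 1 k"
  proof -
    have "k \<le> 1 \<Longrightarrow> (k - 1) * 1 \<le> (k - 1) * w" "k \<le> 1 \<Longrightarrow> (k - 1) * w \<le> 0"
      using w by (intro mult_left_mono_neg, simp_all add: mult_nonpos_nonneg)
    moreover have "1 \<le> k \<Longrightarrow> (k - 1) * w \<le> (k - 1) * 1" "1 \<le> k \<Longrightarrow> 0 \<le> (k - 1) * w"
      using w by (intro mult_left_mono, simp_all)
    ultimately show "min 1 k \<le> 1 + (k - 1) * w" "1 + (k - 1) * w \<le> max 1 k"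
      unfolding min_def max_def by (smt (verit))+
  qed
  ultimately show ?thesis using that by blast
qed

text \<open>The ratio \<open>(k\<^sup>2 * t\<^sup>2 + 1) / (t\<^sup>2 + 1)\<close> is monotonic in \<open>t\<^sup>2\<close>, and it is \<open>(k\<^sup>2 + 1) / 2\<close> at
  \<open>t = 1\<close>. The two inequalities amount to \<open>(1 - t\<^sup>2) * (1 - l\<^sup>2) \<ge> 0\<close> and
  \<open>(1 - t\<^sup>2) * (h\<^sup>2 - 1) \<ge> 0\<close>.\<close>
lemma secant_perturbation:
  fixes t k :: real
  assumes t: "0 \<le> t" "t \<le> 1" and k: "0 \<le> l" "l \<le> 1" "1 \<le> h" "l \<le> k" "k \<le> h"
  shows "sqrt ((l\<^sup>2 + 1) / 2) * sqrt (t\<^sup>2 + 1) \<le> sqrt ((k * t)\<^sup>2 + 1)"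
    "sqrt ((k * t)\<^sup>2 + 1) \<le> sqrt ((h\<^sup>2 + 1) / 2) * sqrt (t\<^sup>2 + 1)"
proof -
  have t2: "t\<^sup>2 \<le> 1" and l2: "l\<^sup>2 \<le> 1" and h2: "1 \<le> h\<^sup>2"
    using t k by (simp_all add: power_le_one one_le_power)
  have lk: "l\<^sup>2 * t\<^sup>2 \<le> k\<^sup>2 * t\<^sup>2" and kh: "k\<^sup>2 * t\<^sup>2 \<le> h\<^sup>2 * t\<^sup>2"
    using k by (simp_all add: mult_right_mono power_mono)
  have "0 \<le> (1 - t\<^sup>2) * (1 - l\<^sup>2)" using t2 l2 by simp
  then have "(l\<^sup>2 + 1) / 2 * (t\<^sup>2 + 1) \<le> (k * t)\<^sup>2 + 1"
    using lk by (simp add: power_mult_distrib algebra_simps)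
  then show "sqrt ((l\<^sup>2 + 1) / 2) * sqrt (t\<^sup>2 + 1) \<le> sqrt ((k * t)\<^sup>2 + 1)"
    unfolding real_sqrt_mult[symmetric] by (rule real_sqrt_le_mono)
  have "0 \<le> (1 - t\<^sup>2) * (h\<^sup>2 - 1)" using t2 h2 by simp
  then have "(k * t)\<^sup>2 + 1 \<le> (h\<^sup>2 + 1) / 2 * (t\<^sup>2 + 1)"
    using kh by (simp add: power_mult_distrib algebra_simps)
  then show "sqrt ((k * t)\<^sup>2 + 1) \<le> sqrt ((h\<^sup>2 + 1) / 2) * sqrt (t\<^sup>2 + 1)"
    unfolding real_sqrt_mult[symmetric] by (rule real_sqrt_le_mono)
qed

section \<open>Operations in the working format\<close>

text \<open>The constant \<open>1 / 100\<close> only needs to be small enough that the products of the few rounding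
  factors below keep everything that is rounded to this format within
  \<open>3 / 2 * \<Omega>\<close>, which is below the overflow threshold.\<close>
locale working_format =
  fixes W :: fp_format
  assumes prec_pos: "1 \<le> prec W"
    and eps_small: "eps W \<le> 1 / 100"
    and emax_pos: "1 \<le> emax W"
begin

abbreviation "u \<equiv> eps W"
abbreviation "\<Omega> \<equiv> (2 :: real) powi emax W"

text \<open>These bound the ratio of the computed and the exact secant: a factor for the error of the
  tangent times one for the rounding of the secant itself.\<close>
abbreviation "sec_lo \<equiv> sqrt (((1 - u)\<^sup>2 + 1) / 2) * (1 - u)"
abbreviation "sec_hi \<equiv> sqrt (((1 + u)\<^sup>2 + 1) / 2) * (1 + u)"

lemma eps_pos: "0 < u"
  by (simp add: eps_def)

lemma Omega_ge: "2 \<le> \<Omega>"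
  using power_int_increasing[OF emax_pos, of "2 :: real"] by simp

lemma rounding_strict:
  assumes "1 / (1 + u) \<le> q" "q \<le> (1 + 2 * u) / (1 + u)"
  shows "1 - u < q" "q < 1 + u"
proof -
  have "1 - u < 1 / (1 + u)" "(1 + 2 * u) / (1 + u) < 1 + u"
    using eps_pos by (simp_all add: field_simps)
  with assms show "1 - u < q" "q < 1 + u" by linarith+
qed

lemma rounding:
  assumes "\<not> underflows W x" "\<bar>x\<bar> \<le> 3 / 2 * \<Omega>"
  obtains q where "fl W x = q * x" "1 / (1 + u) \<le> q" "q \<le> (1 + 2 * u) / (1 + u)"
proof (rule fl_relative_error[OF prec_pos assms(1)])
  have "3 / 2 * \<Omega> < (2 - u) * \<Omega>"
    using eps_small Omega_ge by (intro mult_strict_right_mono) simp_all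
  with assms(2) show "\<bar>x\<bar> < (2 - u) * \<Omega>" by linarith
qed (use that in blast)

lemma sum_magnitude:
  assumes "\<bar>x\<bar> \<le> \<Omega> / 2" "\<bar>y\<bar> \<le> \<Omega> / 2" "0 < t" "t \<le> 1"
  shows "\<bar>x + y * t\<bar> \<le> \<Omega>"
proof -
  have "\<bar>y * t\<bar> \<le> \<Omega> / 2 * 1"
    unfolding abs_mult using assms by (intro mult_mono) simp_all
  with assms(1) show ?thesis by linarith
qed

lemma sec_lo_pos: "0 < sec_lo"
proof -
  have "0 < ((1 - u)\<^sup>2 + 1) / 2" by (simp add: add_nonneg_pos)
  then show ?thesis using eps_small by simp
qed

lemma tangent_rounding:
  assumes "0 < t" "t \<le> 1" "\<not> underflows W t"
  obtains k where "fl W t = k * t" "1 - u < k" "k < 1 + u"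
proof -
  have "\<bar>t\<bar> \<le> 3 / 2 * \<Omega>" using assms(1,2) Omega_ge by linarith
  from rounding[OF assms(3) this] rounding_strict that show ?thesis by metis
qed

lemma secant_rounding:
  assumes t: "0 < t" "t \<le> 1" and k: "1 - u < k" "k < 1 + u"
    and normal: "\<not> underflows W (sqrt ((k * t)\<^sup>2 + 1))"
  obtains b where "hypot W (k * t) 1 = b * sqrt (t\<^sup>2 + 1)" "sec_lo \<le> b" "b \<le> sec_hi"
    "1 - u \<le> hypot W (k * t) 1"
proof -
  define s where "s = sqrt ((k * t)\<^sup>2 + 1)"
  define z where "z = sqrt (t\<^sup>2 + 1)"
  have z: "z > 0" by (simp add: z_def add_nonneg_pos)
  have kt: "0 \<le> k * t" "k * t \<le> 3 / 2"
  proof -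
    show "0 \<le> k * t" using t k eps_small by simp
    have "k * t \<le> (1 + u) * 1" using t k eps_small eps_pos by (intro mult_mono) auto
    then show "k * t \<le> 3 / 2" using eps_small by simp
  qed
  have s1: "1 \<le> s" by (simp add: s_def)
  have "s \<le> \<bar>k * t\<bar> + \<bar>1\<bar>"
    unfolding s_def using sqrt_sum_squares_le_sum_abs[of "k * t" 1] by simp
  then have "\<bar>s\<bar> \<le> 3 / 2 * \<Omega>" using kt s1 Omega_ge by linarith
  then obtain q where q: "fl W s = q * s" "1 / (1 + u) \<le> q" "q \<le> (1 + 2 * u) / (1 + u)"
    using rounding normal unfolding s_def by blast
  note q' = rounding_strict[OF q(2,3)]
  have pert: "sqrt (((1 - u)\<^sup>2 + 1) / 2) * z \<le> s" "s \<le> sqrt (((1 + u)\<^sup>2 + 1) / 2) * z"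
    unfolding s_def z_def
    by (rule secant_perturbation[where l = "1 - u" and h = "1 + u"];
        use t k eps_small eps_pos in simp)+
  have "sqrt (((1 - u)\<^sup>2 + 1) / 2) * (1 - u) \<le> s / z * q"
    using pert q' z eps_small s1
    by (intro mult_mono) (simp_all add: pos_le_divide_eq)
  moreover have "s / z * q \<le> sqrt (((1 + u)\<^sup>2 + 1) / 2) * (1 + u)"
    using pert q' z eps_small s1
    by (intro mult_mono) (simp_all add: pos_divide_le_eq)
  moreover have "hypot W (k * t) 1 = s / z * q * z"
    using q(1) z by (simp add: hypot_def s_def)
  moreover have "1 - u \<le> hypot W (k * t) 1"
  proof -
    have "(1 - u) * 1 \<le> q * s" using q' s1 eps_small by (intro mult_mono) simp_all
    then show ?thesis using q(1) by (simp add: hypot_def s_def)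
  qed
  ultimately show ?thesis using that unfolding z_def by blast
qed

text \<open>The last operation for each element of the second column: the numerator carries an accumulated
  factor \<open>a\<close>, the secant carries \<open>b\<close>. The bounds for \<open>q\<close> are left in the sharp form, because the wide
  computation needs its slack.\<close>
lemma quotient_rounding:
  assumes num: "N = a * n" "0 < a" "a \<le> 6 / 5" "\<bar>n\<bar> \<le> \<Omega>"
    and sf: "sf = b * z" "1 - u \<le> sf"
    and normal: "\<not> underflows W (N / sf)"
  obtains q where "fl W (N / sf) = (a * q / b) * (n / z)"
    "1 / (1 + u) \<le> q" "q \<le> (1 + 2 * u) / (1 + u)"
proof -
  have "\<bar>N\<bar> \<le> 6 / 5 * \<Omega>"
    unfolding num(1) abs_mult using num by (intro mult_mono) simp_all
  also have "\<dots> \<le> 3 / 2 * \<Omega> * (1 - u)"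
    using eps_small by simp
  also have "\<dots> \<le> 3 / 2 * \<Omega> * sf"
    using sf(2) by (intro mult_left_mono) simp_all
  finally have "\<bar>N / sf\<bar> \<le> 3 / 2 * \<Omega>"
    using sf(2) eps_small by (simp add: abs_divide pos_divide_le_eq)
  from rounding[OF normal this] obtain q where
    q: "fl W (N / sf) = q * (N / sf)" "1 / (1 + u) \<le> q" "q \<le> (1 + 2 * u) / (1 + u)" .
  from q(1) have "fl W (N / sf) = (a * q / b) * (n / z)" by (simp add: num(1) sf(1))
  then show ?thesis using q(2,3) that by blast
qed

end

context working_format
begin

text \<open>With an exact tangent, cancellation in the sum is harmless, and only the roundings of the
  numerator, of the secant and of the quotient contribute.\<close>
lemma entry_exact_tangent:
  assumes xy: "\<bar>x\<bar> \<le> \<Omega> / 2" "\<bar>y\<bar> \<le> \<Omega> / 2" and t: "0 < t" "t \<le> 1"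
    and sf: "sf = b * z" "sec_lo \<le> b" "b \<le> sec_hi" "1 - u \<le> sf"
    and normal: "\<not> underflows W (y * t + x)" "\<not> underflows W (fma W y t x / sf)"
  obtains d where "fl W (fma W y t x / sf) = d * ((x + y * t) / z)"
    "(1 - u)\<^sup>2 / sec_hi \<le> d" "d \<le> (1 + u)\<^sup>2 / sec_lo"
proof -
  have n: "\<bar>x + y * t\<bar> \<le> \<Omega>"
    using sum_magnitude[OF xy t] .
  then have "\<bar>y * t + x\<bar> \<le> 3 / 2 * \<Omega>" using Omega_ge by (simp add: add.commute)
  from rounding[OF normal(1) this] obtain p where
    p: "fl W (y * t + x) = p * (y * t + x)" "1 / (1 + u) \<le> p" "p \<le> (1 + 2 * u) / (1 + u)" .
  note p' = rounding_strict[OF p(2,3)]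
  have num: "fma W y t x = p * (x + y * t)"
    using p(1) by (simp add: fma_def add.commute)
  obtain q where q: "fl W (fma W y t x / sf) = (p * q / b) * ((x + y * t) / z)"
      "1 / (1 + u) \<le> q" "q \<le> (1 + 2 * u) / (1 + u)"
    using quotient_rounding[OF num _ _ n sf(1,4) normal(2)] p' eps_small by auto
  note q' = rounding_strict[OF q(2,3)]
  have "(1 - u)\<^sup>2 \<le> p * q" "p * q \<le> (1 + u)\<^sup>2"
    unfolding power2_eq_square using p' q' eps_small by (intro mult_mono; simp)+
  then have "(1 - u)\<^sup>2 / sec_hi \<le> p * q / b" "p * q / b \<le> (1 + u)\<^sup>2 / sec_lo"
    using sf(2,3) sec_lo_pos p' q' eps_small by (intro frac_le; simp)+
  with q(1) that show ?thesis by blast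
qed

text \<open>The case of an inexact tangent without cancellation: three factors \<open>1 \<plusminus> u\<close> arise from the
  tangent, from the numerator and from the quotient. For the upper element of the second column,
  \<open>x\<close> and \<open>y\<close> are the upper and the lower element of the pivoted column; for the lower one, they are
  the lower and the negated upper element.\<close>
lemma entry_same_signs:
  assumes xy: "\<bar>x\<bar> \<le> \<Omega> / 2" "\<bar>y\<bar> \<le> \<Omega> / 2" "0 \<le> x * y" and t: "0 < t" "t \<le> 1"
    and k: "1 - u < k" "k < 1 + u"
    and sf: "sf = b * z" "sec_lo \<le> b" "b \<le> sec_hi" "1 - u \<le> sf"
    and normal: "\<not> underflows W (y * (k * t) + x)" "\<not> underflows W (fma W y (k * t) x / sf)"
  obtains d where "fl W (fma W y (k * t) x / sf) = d * ((x + y * t) / z)"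
    "(1 - u) ^ 3 / sec_hi < d" "d < (1 + u) ^ 3 / sec_lo"
proof -
  have n: "\<bar>x + y * t\<bar> \<le> \<Omega>"
    using sum_magnitude[OF xy(1,2) t] .
  have "0 \<le> x * (y * t)"
    using mult_nonneg_nonneg[OF xy(3), of t] t by (simp add: mult.assoc)
  then obtain k' where "x + k * (y * t) = k' * (x + y * t)" "min 1 k \<le> k'" "k' \<le> max 1 k"
    by (rule sum_perturbation)
  then have arg: "y * (k * t) + x = k' * (x + y * t)" and k': "1 - u < k'" "k' < 1 + u"
    using k eps_pos by (auto simp: ac_simps)
  have "\<bar>k' * (x + y * t)\<bar> \<le> 3 / 2 * \<Omega>"
    unfolding abs_mult using k' n eps_small by (intro mult_mono) simp_all
  then obtain p where p: "fl W (y * (k * t) + x) = p * (k' * (x + y * t))"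
      "1 / (1 + u) \<le> p" "p \<le> (1 + 2 * u) / (1 + u)"
    using rounding[OF normal(1)] unfolding arg by blast
  note p' = rounding_strict[OF p(2,3)]
  have num: "fma W y (k * t) x = k' * p * (x + y * t)"
    using p(1) by (simp add: fma_def mult.commute mult.left_commute)
  have kp: "(1 - u) * (1 - u) < k' * p" "k' * p < (1 + u) * (1 + u)"
    using k' p' eps_small by (intro mult_strict_mono; simp)+
  have "(1 + u) * (1 + u) \<le> (101 / 100) * (101 / 100)"
    using eps_small eps_pos by (intro mult_mono) simp_all
  with kp have "k' * p \<le> 6 / 5" by simp
  moreover have "0 < k' * p" using k' p' eps_small by simp
  ultimately obtain q where
    q: "fl W (fma W y (k * t) x / sf) = (k' * p * q / b) * ((x + y * t) / z)"
      "1 / (1 + u) \<le> q" "q \<le> (1 + 2 * u) / (1 + u)"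
    using quotient_rounding[OF num _ _ n sf(1,4) normal(2)] by blast
  note q' = rounding_strict[OF q(2,3)]
  have "(1 - u) ^ 3 < k' * p * q" "k' * p * q < (1 + u) ^ 3"
    unfolding power3_eq_cube using kp q' eps_small k' p' by (intro mult_strict_mono; simp)+
  then have "(1 - u) ^ 3 / sec_hi < k' * p * q / b" "k' * p * q / b < (1 + u) ^ 3 / sec_lo"
    using sf(2,3) sec_lo_pos \<open>0 < k' * p\<close> q' eps_small by (intro frac_less; simp)+
  with q(1) that show ?thesis by blast
qed

end

section \<open>Operations in the wider format\<close>

text \<open>The exponent range must accommodate products of two working values, and the precision must be
  slightly more than twice the working one, so that \<open>u\<^sub>T\<close> is a fraction of \<open>u\<^sup>2\<close>.\<close>
locale wider_format = working_format +
  fixes T :: fp_format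
  assumes wide_prec_pos: "1 \<le> prec T"
    and wide_eps: "4 * eps T \<le> (eps W)\<^sup>2"
    and wide_emax: "2 * emax W \<le> emax T"
begin

abbreviation "u\<^sub>T \<equiv> eps T"

lemma wide_eps_pos: "0 < u\<^sub>T"
  by (simp add: eps_def)

lemma Omega_square: "\<Omega> * \<Omega> \<le> 2 powi emax T"
proof -
  have "\<Omega> * \<Omega> = 2 powi (2 * emax W)" unfolding mult_2 by (subst power_int_add) simp_all
  then show ?thesis using power_int_increasing[OF wide_emax, of "2 :: real"] by simp
qed

lemma wide_eps_small: "u\<^sub>T \<le> 1 / 100"
proof -
  have "u\<^sup>2 \<le> (1 / 100)\<^sup>2" using eps_small eps_pos by (intro power_mono) simp_all
  with wide_eps show ?thesis by (simp add: power2_eq_square)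
qed

lemma wide_rounding:
  assumes "\<not> underflows T x" "\<bar>x\<bar> \<le> \<Omega> * \<Omega>"
  obtains q where "fl T x = q * x" "1 - u\<^sub>T \<le> q" "q \<le> 1 + u\<^sub>T"
proof (rule fl_relative_error[OF wide_prec_pos assms(1)])
  have "1 * 2 powi emax T < (2 - u\<^sub>T) * 2 powi emax T"
    using wide_eps_small by (intro mult_strict_right_mono) simp_all
  with assms(2) Omega_square show "\<bar>x\<bar> < (2 - u\<^sub>T) * 2 powi emax T" by linarith
next
  fix q assume q: "fl T x = q * x" "1 / (1 + u\<^sub>T) \<le> q" "q \<le> (1 + 2 * u\<^sub>T) / (1 + u\<^sub>T)"
  have "1 - u\<^sub>T \<le> 1 / (1 + u\<^sub>T)" "(1 + 2 * u\<^sub>T) / (1 + u\<^sub>T) \<le> 1 + u\<^sub>T"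
    using wide_eps_pos by (simp_all add: field_simps)
  with q have "1 - u\<^sub>T \<le> q" "q \<le> 1 + u\<^sub>T" by linarith+
  with q(1) show ?thesis by (rule that)
qed

text \<open>One factor \<open>1 \<plusminus> u\<^sub>T\<close> is absorbed by the roundings to the working format. For the
  lower bound this means \<open>((1 - u) * (1 + u))\<^sup>2 \<le> 1 - u\<^sub>T\<close>, where the left-hand side is about
  \<open>1 - 2 * u\<^sup>2\<close>; for the upper bound, \<open>(1 + u\<^sub>T) * (1 + 2 * u)\<^sup>2 \<le> (1 + u)^4\<close>, where
  \<open>(1 + u)\<^sup>2 = 1 + 2 * u + u\<^sup>2\<close>.\<close>
lemma double_rounding_slack:
  "(1 - u\<^sub>T) * (1 - u)\<^sup>2 \<le> (1 - u\<^sub>T)\<^sup>2 * (1 / (1 + u))\<^sup>2"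
  "(1 + u\<^sub>T)\<^sup>2 * ((1 + 2 * u) / (1 + u))\<^sup>2 \<le> (1 + u\<^sub>T) * (1 + u)\<^sup>2"
proof -
  have e2: "u\<^sup>2 \<le> 1" using eps_small eps_pos by (intro power_le_one) simp_all
  have "((1 - u) * (1 + u))\<^sup>2 = 1 - 2 * u\<^sup>2 + u\<^sup>2 * u\<^sup>2"
    by (simp add: power2_eq_square algebra_simps)
  also have "\<dots> \<le> 1 - u\<^sup>2"
    using mult_right_mono[OF e2, of "u\<^sup>2"] by simp
  also have "\<dots> \<le> 1 - u\<^sub>T" using wide_eps wide_eps_pos by linarith
  finally have "(1 - u)\<^sup>2 \<le> (1 - u\<^sub>T) * (1 / (1 + u))\<^sup>2"
    using eps_pos by (simp add: power_mult_distrib power_divide pos_le_divide_eq)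
  then have "(1 - u\<^sub>T) * (1 - u)\<^sup>2 \<le> (1 - u\<^sub>T) * ((1 - u\<^sub>T) * (1 / (1 + u))\<^sup>2)"
    using wide_eps_small by (intro mult_left_mono) simp_all
  then show "(1 - u\<^sub>T) * (1 - u)\<^sup>2 \<le> (1 - u\<^sub>T)\<^sup>2 * (1 / (1 + u))\<^sup>2"
    by (simp add: power2_eq_square[of "1 - u\<^sub>T"])
  have "(1 + 2 * u)\<^sup>2 \<le> 2\<^sup>2"
    using eps_small eps_pos by (intro power_mono) simp_all
  then have "u\<^sub>T * (1 + 2 * u)\<^sup>2 \<le> u\<^sub>T * 4"
    using wide_eps_pos by (intro mult_left_mono) simp_all
  then have "(1 + u\<^sub>T) * (1 + 2 * u)\<^sup>2 \<le> (1 + 2 * u)\<^sup>2 + u\<^sup>2"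
    using wide_eps by (simp add: algebra_simps)
  also have "\<dots> \<le> (1 + 2 * u)\<^sup>2 + 2 * (1 + 2 * u) * u\<^sup>2 + (u\<^sup>2)\<^sup>2"
  proof -
    have "1 * u\<^sup>2 \<le> 2 * (1 + 2 * u) * u\<^sup>2"
      using eps_pos by (intro mult_right_mono) simp_all
    then show ?thesis using zero_le_power2[of "u\<^sup>2"] by linarith
  qed
  also have "\<dots> = (1 + u)\<^sup>2 * (1 + u)\<^sup>2"
    by (simp add: power2_eq_square algebra_simps)
  finally have "(1 + u\<^sub>T) * ((1 + 2 * u) / (1 + u))\<^sup>2 \<le> (1 + u)\<^sup>2"
    using eps_pos by (simp add: power_divide pos_divide_le_eq)
  then have "(1 + u\<^sub>T) * ((1 + u\<^sub>T) * ((1 + 2 * u) / (1 + u))\<^sup>2) \<le> (1 + u\<^sub>T) * (1 + u)\<^sup>2"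
    using wide_eps_pos by (intro mult_left_mono) simp_all
  then show "(1 + u\<^sub>T)\<^sup>2 * ((1 + 2 * u) / (1 + u))\<^sup>2 \<le> (1 + u\<^sub>T) * (1 + u)\<^sup>2"
    by (simp add: power2_eq_square[of "1 + u\<^sub>T"] mult.assoc)
qed

text \<open>As \<open>D / g = x + y * t\<close> holds for the exact tangent \<open>t\<close>, cancellation in \<open>D\<close> happens before any
  rounding and does no harm. The factors \<open>p1\<close> and \<open>p2\<close> stem from the wider format, \<open>p\<close> and \<open>q\<close> from
  the working one.\<close>
lemma entry_wide:
  assumes xy: "\<bar>x\<bar> \<le> \<Omega> / 2" "\<bar>y\<bar> \<le> \<Omega> / 2"
    and g: "0 < g'" "g' \<le> g" "g \<le> \<Omega> / 2" "t = g' / g"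
    and sf: "sf = b * z" "sec_lo \<le> b" "b \<le> sec_hi" "1 - u \<le> sf"
    and D: "D = x * g + y * g'"
    and normal: "\<not> wide_quotient_underflows W T D g"
      "\<not> underflows W (wide_quotient W T D g / sf)"
  obtains d where "fl W (wide_quotient W T D g / sf) = d * ((x + y * t) / z)"
    "(1 - u\<^sub>T) * (1 - u)\<^sup>2 / sec_hi \<le> d" "d \<le> (1 + u\<^sub>T) * (1 + u)\<^sup>2 / sec_lo"
proof -
  have t: "0 < t" "t \<le> 1" using g by simp_all
  define n where "n = x + y * t"
  have n: "\<bar>n\<bar> \<le> \<Omega>" unfolding n_def using sum_magnitude[OF xy t] .
  have normal_steps: "\<not> underflows T D" "\<not> underflows T (fl T D / g)"
    "\<not> underflows W (fl T (fl T D / g))"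
    using normal(1) by (simp_all add: wide_quotient_underflows_def)
  have Dn: "D = n * g" using g by (simp add: D n_def field_simps)
  have OO: "101 / 100 * \<Omega> \<le> \<Omega> * \<Omega>"
    using Omega_ge by (intro mult_right_mono) simp_all
  have "\<bar>D\<bar> \<le> \<Omega> * \<Omega>"
    unfolding Dn abs_mult using n g Omega_ge by (intro mult_mono) simp_all
  with normal_steps(1) obtain p1 where p1: "fl T D = p1 * D" "1 - u\<^sub>T \<le> p1" "p1 \<le> 1 + u\<^sub>T"
    by (rule wide_rounding)
  have q1: "fl T D / g = p1 * n" unfolding p1(1) using g by (simp add: Dn)
  have p1n: "\<bar>p1 * n\<bar> \<le> 101 / 100 * \<Omega>"
    unfolding abs_mult using p1 n wide_eps_small by (intro mult_mono) simp_all
  then have "\<bar>p1 * n\<bar> \<le> \<Omega> * \<Omega>" using OO by linarith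
  with normal_steps(2)[unfolded q1]
  obtain p2 where p2: "fl T (p1 * n) = p2 * (p1 * n)" "1 - u\<^sub>T \<le> p2" "p2 \<le> 1 + u\<^sub>T"
    by (rule wide_rounding)
  have pp: "(1 - u\<^sub>T)\<^sup>2 \<le> p2 * p1" "p2 * p1 \<le> (1 + u\<^sub>T)\<^sup>2"
    unfolding power2_eq_square using p1 p2 wide_eps_small by (intro mult_mono; simp)+
  have "\<bar>p2 * (p1 * n)\<bar> \<le> 101 / 100 * (101 / 100 * \<Omega>)"
    unfolding abs_mult[of p2] using p1n p2 wide_eps_small by (intro mult_mono) simp_all
  then have "\<bar>p2 * (p1 * n)\<bar> \<le> 3 / 2 * \<Omega>" using Omega_ge by simp
  with normal_steps(3)[unfolded q1 p2(1)]
  obtain p where p: "fl W (p2 * (p1 * n)) = p * (p2 * (p1 * n))"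
      "1 / (1 + u) \<le> p" "p \<le> (1 + 2 * u) / (1 + u)"
    by (rule rounding)
  note p' = rounding_strict[OF p(2,3)]
  have num: "wide_quotient W T D g = (p2 * p1) * p * n"
    unfolding wide_quotient_def q1 p2(1) p(1) by simp
  have pos: "0 < p2 * p1" "0 < p" using p1 p2 p' wide_eps_small eps_small by simp_all
  have "p2 * p1 * p \<le> (101 / 100) * (101 / 100) * (101 / 100)"
    using p1 p2 p' wide_eps_small eps_small by (intro mult_mono) simp_all
  then obtain q where
    q: "fl W (wide_quotient W T D g / sf) = ((p2 * p1) * p * q / b) * (n / z)"
      "1 / (1 + u) \<le> q" "q \<le> (1 + 2 * u) / (1 + u)"
    using quotient_rounding[OF num _ _ n sf(1,4) normal(2)] pos by auto
  note q' = rounding_strict[OF q(2,3)]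
  have pq: "(1 / (1 + u))\<^sup>2 \<le> p * q" "p * q \<le> ((1 + 2 * u) / (1 + u))\<^sup>2"
    unfolding power2_eq_square using p q p' q' eps_small eps_pos
    by (intro mult_mono; simp)+
  have "(1 - u\<^sub>T)\<^sup>2 * (1 / (1 + u))\<^sup>2 \<le> (p2 * p1) * (p * q)"
    using pp pq pos by (intro mult_mono) simp_all
  then have lower: "(1 - u\<^sub>T) * (1 - u)\<^sup>2 \<le> (p2 * p1) * p * q"
    using double_rounding_slack(1) by (simp add: mult.assoc)
  have "(p2 * p1) * (p * q) \<le> (1 + u\<^sub>T)\<^sup>2 * ((1 + 2 * u) / (1 + u))\<^sup>2"
    using pp pq pos q' eps_small by (intro mult_mono) simp_all
  then have upper: "(p2 * p1) * p * q \<le> (1 + u\<^sub>T) * (1 + u)\<^sup>2"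
    using double_rounding_slack(2) by (simp add: mult.assoc)
  have "(1 - u\<^sub>T) * (1 - u)\<^sup>2 / sec_hi \<le> (p2 * p1) * p * q / b"
    using lower sf(2,3) sec_lo_pos pos q' eps_small by (intro frac_le) simp_all
  moreover have "(p2 * p1) * p * q / b \<le> (1 + u\<^sub>T) * (1 + u)\<^sup>2 / sec_lo"
    using upper sf(2,3) sec_lo_pos wide_eps_pos by (intro frac_le) simp_all
  ultimately show ?thesis using q(1) that unfolding n_def by blast
qed

end

lemma standard_formats:
  assumes "(W, T) \<in> {(binary32, binary64), (binary64, binary128)}"
  shows "wider_format W T"
proof -
  have "(2 :: real) powi (- 24) = 1 / 2 ^ 24" "(2 :: real) powi (- 53) = 1 / 2 ^ 53"
    "(2 :: real) powi (- 113) = 1 / 2 ^ 113"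
    by (simp_all add: power_int_minus field_simps)
  then show ?thesis using assms
    by (auto simp: wider_format_def working_format_def wider_format_axioms_def eps_def
        binary32_def binary64_def binary128_def power2_eq_square)
qed

section \<open>The computed triangular factor\<close>

lemma abs_of_multiple:
  fixes l :: real
  assumes "a = d * r" "0 < l" "l \<le> d"
  shows "\<bar>a\<bar> = d * \<bar>r\<bar>"
  using assms by (simp add: abs_mult)

theorem theorem3p4:
  fixes W T :: fp_format and G :: "real^2^2" and \<epsilon> \<epsilon>\<^sub>T :: real
  assumes formats: "(W, T) \<in> {(binary32, binary64), (binary64, binary128)}"
    and eps: "\<epsilon> = eps W" "\<epsilon>\<^sub>T = eps T"
    and G: "\<And>i j. G $ i $ j \<in> fp_values W" "\<And>i j. G $ i $ j \<noteq> 0"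
    and formed: "R_fp_formed W T G"
    and no_underflow: "no_underflow W T G"
  shows
    "(\<exists>\<delta>0. R_fp W T G $ 1 $ 1 = \<delta>0 * R_exact W G $ 1 $ 1 \<and> 1 - \<epsilon> \<le> \<delta>0 \<and> \<delta>0 \<le> 1 + \<epsilon>) \<and>
     (tan_exact W G \<longrightarrow>
       (\<exists>\<delta>1' \<delta>1''.
          R_fp W T G $ 1 $ 2 = \<delta>1' * R_exact W G $ 1 $ 2 \<and>
          R_fp W T G $ 2 $ 2 = \<delta>1'' * R_exact W G $ 2 $ 2 \<and>
          (\<forall>\<delta>\<in>{\<delta>1', \<delta>1''}.
             (1 - \<epsilon>)^2 / (sqrt (((1 + \<epsilon>)^2 + 1) / 2) * (1 + \<epsilon>)) \<le> \<delta> \<and>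
             \<delta> \<le> (1 + \<epsilon>)^2 / (sqrt (((1 - \<epsilon>)^2 + 1) / 2) * (1 - \<epsilon>))))) \<and>
     (\<not> tan_exact W G \<and> same_signs W G \<longrightarrow>
       (\<exists>\<delta>2' \<delta>3'.
          R_fp W T G $ 1 $ 2 = \<delta>2' * R_exact W G $ 1 $ 2 \<and>
          R_fp W T G $ 2 $ 2 = \<delta>3' * R_exact W G $ 2 $ 2 \<and>
          (1 - \<epsilon>)^3 / (sqrt (((1 + \<epsilon>)^2 + 1) / 2) * (1 + \<epsilon>)) < \<delta>2' \<and>
          \<delta>2' < (1 + \<epsilon>)^3 / (sqrt (((1 - \<epsilon>)^2 + 1) / 2) * (1 - \<epsilon>)) \<and>
          (1 - \<epsilon>\<^sub>T) * (1 - \<epsilon>)^2 / (sqrt (((1 + \<epsilon>)^2 + 1) / 2) * (1 + \<epsilon>)) \<le> \<delta>3' \<and>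
          \<delta>3' \<le> (1 + \<epsilon>\<^sub>T) * (1 + \<epsilon>)^2 / (sqrt (((1 - \<epsilon>)^2 + 1) / 2) * (1 - \<epsilon>)))) \<and>
     (\<not> tan_exact W G \<and> opposite_signs W G \<longrightarrow>
       (\<exists>\<delta>2'' \<delta>3''.
          R_fp W T G $ 2 $ 2 = \<delta>2'' * R_exact W G $ 2 $ 2 \<and>
          R_fp W T G $ 1 $ 2 = \<delta>3'' * R_exact W G $ 1 $ 2 \<and>
          (1 - \<epsilon>)^3 / (sqrt (((1 + \<epsilon>)^2 + 1) / 2) * (1 + \<epsilon>)) < \<delta>2'' \<and>
          \<delta>2'' < (1 + \<epsilon>)^3 / (sqrt (((1 - \<epsilon>)^2 + 1) / 2) * (1 - \<epsilon>)) \<and>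
          (1 - \<epsilon>\<^sub>T) * (1 - \<epsilon>)^2 / (sqrt (((1 + \<epsilon>)^2 + 1) / 2) * (1 + \<epsilon>)) \<le> \<delta>3'' \<and>
          \<delta>3'' \<le> (1 + \<epsilon>\<^sub>T) * (1 + \<epsilon>)^2 / (sqrt (((1 - \<epsilon>)^2 + 1) / 2) * (1 - \<epsilon>))))"
proof -
  interpret wider_format W T using standard_formats[OF formats] .
  define H where "H = pivoted_fp W G"
  define a b c d where abcd: "a = H $ 1 $ 1" "b = H $ 2 $ 1" "c = H $ 1 $ 2" "d = H $ 2 $ 2"
  have scale_normal: "\<not> underflows W (2 powi scale_exponent W G * G $ i $ j)"
    and norm_normal: "\<not> underflows W (sqrt ((scaled_fp W G $ 1 $ j)\<^sup>2 + (scaled_fp W G $ 2 $ j)\<^sup>2))"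
    and tan_normal: "\<not> underflows W (H $ 2 $ 1 / H $ 1 $ 1)"
    and sec_normal: "\<not> underflows W (sqrt ((tan_fp W G)\<^sup>2 + 1\<^sup>2))"
    and numerators_normal: "\<not> numerator12_underflows W T G" "\<not> numerator22_underflows W T G"
    and quotients_normal: "\<not> underflows W (numerator12_fp W T G / sec_fp W G)"
      "\<not> underflows W (numerator22_fp W T G / sec_fp W G)" for i j
    using no_underflow by (simp_all only: no_underflow_def Let_def H_def simp_thms)
  have scaled: "scaled_fp W G = scaled W G"
    using prec_pos G scale_normal by (rule scaled_fp_exact)
  have H: "pivoted W G = H" "H = pivot W (scaled W G) (scaled W G)"
    by (simp_all add: H_def pivoted_def pivoted_fp_def scaled)
  have nz: "\<And>i j. scaled W G $ i $ j \<noteq> 0" using G(2) by (simp add: scaled_def)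
  have small: "\<bar>H $ i $ j\<bar> < \<Omega> / 2" for i j
    unfolding H(2) using nz scaled_magnitude[OF prec_pos G(2)] by (rule pivot_magnitude)
  have ab: "0 < b" "b \<le> a"
    unfolding abcd H(2) using pivot_first_column(1,2)[OF nz] by blast+
  have bounds: "a \<le> \<Omega> / 2" "\<bar>c\<bar> \<le> \<Omega> / 2" "\<bar>d\<bar> \<le> \<Omega> / 2" "\<bar>- c\<bar> \<le> \<Omega> / 2"
    using small[of 1 1] small[of 1 2] small[of 2 2] by (simp_all add: abcd)

  define t where "t = b / a"
  define z where "z = sqrt (t\<^sup>2 + 1)"
  have t: "0 < t" "t \<le> 1" using ab by (simp_all add: t_def)
  have tan: "tan_theta W G = t" by (simp add: tan_theta_def H t_def abcd)
  have z: "sec_theta W G = z" by (simp add: sec_theta_def tan z_def)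
  have r: "r12'' W G = (c + d * t) / z" "r22'' W G = (d + - c * t) / z"
    by (simp_all add: r12''_def r22''_def H(1) tan z abcd)
  have tan_fl: "tan_fp W G = fl W t" by (simp add: tan_fp_def H_def[symmetric] t_def abcd)
  have "\<not> underflows W t" using tan_normal by (simp add: t_def abcd)
  with t obtain k where k: "fl W t = k * t" "1 - u < k" "k < 1 + u"
    by (rule tangent_rounding)
  have tf: "tan_fp W G = k * t" by (simp add: tan_fl k(1))
  define sf where "sf = sec_fp W G"
  have sf_hypot: "sf = hypot W (k * t) 1" by (simp add: sf_def sec_fp_def tf)
  have "\<not> underflows W (sqrt ((k * t)\<^sup>2 + 1))" using sec_normal by (simp add: tf)
  with t k(2,3) obtain e where e: "sf = e * z" "sec_lo \<le> e" "e \<le> sec_hi" "1 - u \<le> sf"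
    unfolding sf_hypot z_def by (rule secant_rounding)
  have exact_iff: "tan_exact W G \<longleftrightarrow> k * t = t" by (simp add: tan_exact_def tf tan)
  have same_iff: "same_signs W G \<longleftrightarrow> sgn c = sgn d"
    and opposite_iff: "opposite_signs W G \<longleftrightarrow> sgn c = - sgn d"
    by (simp_all add: same_signs_def opposite_signs_def H_def[symmetric] abcd)

  define N12 N22 where N: "N12 = numerator12_fp W T G" "N22 = numerator22_fp W T G"
  have quotient_normal: "\<not> underflows W (N12 / sf)" "\<not> underflows W (N22 / sf)"
    using quotients_normal by (simp_all add: N sf_def)
  have R: "R_fp W T G $ 1 $ 2 = \<bar>fl W (N12 / sf)\<bar>" "R_fp W T G $ 2 $ 2 = \<bar>fl W (N22 / sf)\<bar>"
    "R_exact W G $ 1 $ 2 = \<bar>(c + d * t) / z\<bar>" "R_exact W G $ 2 $ 2 = \<bar>(d + - c * t) / z\<bar>"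
    unfolding N sf_def by (simp_all add: R_fp_def R_exact_def mat2_def r12''_fp_def r22''_fp_def r)
  have fma12: "N12 = fma W d (k * t) c" "\<not> underflows W (d * (k * t) + c)"
    if "tan_exact W G \<or> \<not> opposite_signs W G"
    using that numerators_normal
    by (auto simp: N numerator12_fp_def numerator12_underflows_def Let_def tf abcd H_def[symmetric])
  have fma22: "N22 = fma W (- c) (k * t) d" "\<not> underflows W (- c * (k * t) + d)"
    if "tan_exact W G \<or> \<not> same_signs W G"
    using that numerators_normal
    by (auto simp: N numerator22_fp_def numerator22_underflows_def Let_def tf abcd H_def[symmetric])
  have wide12: "N12 = wide_quotient W T (c * a + d * b) a"
    "\<not> wide_quotient_underflows W T (c * a + d * b) a"
    if "\<not> tan_exact W G" "opposite_signs W G"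
    using that numerators_normal
    by (auto simp: N numerator12_fp_def numerator12_underflows_def Let_def abcd H_def[symmetric])
  have wide22: "N22 = wide_quotient W T (d * a - c * b) a"
    "\<not> wide_quotient_underflows W T (d * a - c * b) a"
    if "\<not> tan_exact W G" "same_signs W G"
    using that numerators_normal
    by (auto simp: N numerator22_fp_def numerator22_underflows_def Let_def abcd H_def[symmetric])
  \<comment> \<open>If both were zero, both sign conditions would hold at once.\<close>
  have nonzero: "c \<noteq> 0" "d \<noteq> 0"
    unfolding abcd H(2) using pivot_nonzero[OF nz] by blast+
  have lo_pos: "0 < (1 - u)\<^sup>2 / sec_hi" "0 < (1 - u) ^ 3 / sec_hi"
    "0 < (1 - u\<^sub>T) * (1 - u)\<^sup>2 / sec_hi"
  proof -
    have "0 < sec_hi" using e(2,3) sec_lo_pos by linarith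
    then show "0 < (1 - u)\<^sup>2 / sec_hi" "0 < (1 - u) ^ 3 / sec_hi"
      "0 < (1 - u\<^sub>T) * (1 - u)\<^sup>2 / sec_hi"
      using eps_small wide_eps_small by (auto intro!: divide_pos_pos mult_pos_pos zero_less_power)
  qed

  have norm: "\<exists>\<delta>0. R_fp W T G $ 1 $ 1 = \<delta>0 * R_exact W G $ 1 $ 1 \<and> 1 - u \<le> \<delta>0 \<and> \<delta>0 \<le> 1 + u"
  proof -
    \<comment> \<open>The norm is computed from the scaled matrix, before the signs and the order of the rows
      are changed.\<close>
    define j :: 2 where "j = (if swaps_columns W (scaled W G) then 2 else 1)"
    define w where "w = sqrt (a\<^sup>2 + b\<^sup>2)"
    have w: "w = sqrt ((scaled W G $ 1 $ j)\<^sup>2 + (scaled W G $ 2 $ j)\<^sup>2)"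
      using pivot_first_column(3)[OF nz, of W] by (simp add: w_def abcd H(2) j_def)
    have "\<not> underflows W w" unfolding w using norm_normal[of j] unfolding scaled .
    moreover have "\<bar>w\<bar> \<le> 3 / 2 * \<Omega>"
    proof -
      have "w \<le> \<bar>a\<bar> + \<bar>b\<bar>" unfolding w_def by (rule sqrt_sum_squares_le_sum_abs)
      moreover have "0 \<le> w" by (simp add: w_def)
      ultimately show ?thesis using ab bounds(1) Omega_ge by linarith
    qed
    ultimately obtain q where q: "fl W w = q * w" "1 / (1 + u) \<le> q" "q \<le> (1 + 2 * u) / (1 + u)"
      by (rule rounding)
    have "R_fp W T G $ 1 $ 1 = fl W w"
      by (simp add: R_fp_def mat2_def r11''_fp_def column_norm_fp_def hypot_def scaled w j_def)
    moreover have "R_exact W G $ 1 $ 1 = w"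
      by (simp add: R_exact_def mat2_def r11''_def H(1) w_def abcd)
    ultimately show ?thesis using q(1) rounding_strict[OF q(2,3)] by (intro exI[of _ q]) simp
  qed

  have exact: "\<exists>\<delta>1' \<delta>1''.
      R_fp W T G $ 1 $ 2 = \<delta>1' * R_exact W G $ 1 $ 2 \<and>
      R_fp W T G $ 2 $ 2 = \<delta>1'' * R_exact W G $ 2 $ 2 \<and>
      (\<forall>\<delta>\<in>{\<delta>1', \<delta>1''}. (1 - u)\<^sup>2 / sec_hi \<le> \<delta> \<and> \<delta> \<le> (1 + u)\<^sup>2 / sec_lo)"
    if ex: "tan_exact W G"
  proof -
    have kt: "k * t = t" using ex exact_iff by simp
    note f12 = fma12[OF disjI1[OF ex], unfolded kt] and f22 = fma22[OF disjI1[OF ex], unfolded kt]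
    obtain d1 where d1: "fl W (N12 / sf) = d1 * ((c + d * t) / z)"
        "(1 - u)\<^sup>2 / sec_hi \<le> d1" "d1 \<le> (1 + u)\<^sup>2 / sec_lo"
      using quotient_normal(1) unfolding f12(1)
      by (rule entry_exact_tangent[OF bounds(2,3) t e f12(2)])
    obtain d2 where d2: "fl W (N22 / sf) = d2 * ((d + - c * t) / z)"
        "(1 - u)\<^sup>2 / sec_hi \<le> d2" "d2 \<le> (1 + u)\<^sup>2 / sec_lo"
      using quotient_normal(2) unfolding f22(1)
      by (rule entry_exact_tangent[OF bounds(3,4) t e f22(2)])
    show ?thesis unfolding R
      using abs_of_multiple[OF d1(1) lo_pos(1) d1(2)] abs_of_multiple[OF d2(1) lo_pos(1) d2(2)] d1 d2
      by (intro exI[of _ d1] exI[of _ d2]) simp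
  qed

  have same: "\<exists>\<delta>2' \<delta>3'.
      R_fp W T G $ 1 $ 2 = \<delta>2' * R_exact W G $ 1 $ 2 \<and>
      R_fp W T G $ 2 $ 2 = \<delta>3' * R_exact W G $ 2 $ 2 \<and>
      (1 - u) ^ 3 / sec_hi < \<delta>2' \<and> \<delta>2' < (1 + u) ^ 3 / sec_lo \<and>
      (1 - u\<^sub>T) * (1 - u)\<^sup>2 / sec_hi \<le> \<delta>3' \<and> \<delta>3' \<le> (1 + u\<^sub>T) * (1 + u)\<^sup>2 / sec_lo"
    if inexact: "\<not> tan_exact W G" and signs: "same_signs W G"
  proof -
    have "\<not> opposite_signs W G" "0 \<le> c * d"
      using signs nonzero unfolding same_iff opposite_iff
      by (auto simp: sgn_if zero_le_mult_iff split: if_splits)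
    note f12 = fma12[OF disjI2[OF this(1)]] and cd = this(2)
    note w22 = wide22[OF inexact signs]
    have det: "d * a - c * b = d * a + - c * b" by simp
    obtain d1 where d1: "fl W (N12 / sf) = d1 * ((c + d * t) / z)"
        "(1 - u) ^ 3 / sec_hi < d1" "d1 < (1 + u) ^ 3 / sec_lo"
      using quotient_normal(1) unfolding f12(1)
      by (rule entry_same_signs[OF bounds(2,3) cd t k(2,3) e f12(2)])
    obtain d2 where d2: "fl W (N22 / sf) = d2 * ((d + - c * t) / z)"
        "(1 - u\<^sub>T) * (1 - u)\<^sup>2 / sec_hi \<le> d2" "d2 \<le> (1 + u\<^sub>T) * (1 + u)\<^sup>2 / sec_lo"
      using quotient_normal(2) unfolding w22(1)
      by (rule entry_wide[OF bounds(3,4) ab bounds(1) t_def e det w22(2)])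
    show ?thesis unfolding R
      using abs_of_multiple[OF d1(1) lo_pos(2) less_imp_le[OF d1(2)]]
        abs_of_multiple[OF d2(1) lo_pos(3) d2(2)] d1 d2
      by (intro exI[of _ d1] exI[of _ d2]) simp
  qed

  have opposite: "\<exists>\<delta>2'' \<delta>3''.
      R_fp W T G $ 2 $ 2 = \<delta>2'' * R_exact W G $ 2 $ 2 \<and>
      R_fp W T G $ 1 $ 2 = \<delta>3'' * R_exact W G $ 1 $ 2 \<and>
      (1 - u) ^ 3 / sec_hi < \<delta>2'' \<and> \<delta>2'' < (1 + u) ^ 3 / sec_lo \<and>
      (1 - u\<^sub>T) * (1 - u)\<^sup>2 / sec_hi \<le> \<delta>3'' \<and> \<delta>3'' \<le> (1 + u\<^sub>T) * (1 + u)\<^sup>2 / sec_lo"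
    if inexact: "\<not> tan_exact W G" and signs: "opposite_signs W G"
  proof -
    have "\<not> same_signs W G" "0 \<le> d * - c"
      using signs nonzero unfolding same_iff opposite_iff
      by (auto simp: sgn_if mult_le_0_iff split: if_splits)
    note f22 = fma22[OF disjI2[OF this(1)]] and dc = this(2)
    note w12 = wide12[OF inexact signs]
    obtain d1 where d1: "fl W (N12 / sf) = d1 * ((c + d * t) / z)"
        "(1 - u\<^sub>T) * (1 - u)\<^sup>2 / sec_hi \<le> d1" "d1 \<le> (1 + u\<^sub>T) * (1 + u)\<^sup>2 / sec_lo"
      using quotient_normal(1) unfolding w12(1)
      by (rule entry_wide[OF bounds(2,3) ab bounds(1) t_def e refl w12(2)])
    obtain d2 where d2: "fl W (N22 / sf) = d2 * ((d + - c * t) / z)"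
        "(1 - u) ^ 3 / sec_hi < d2" "d2 < (1 + u) ^ 3 / sec_lo"
      using quotient_normal(2) unfolding f22(1)
      by (rule entry_same_signs[OF bounds(3,4) dc t k(2,3) e f22(2)])
    show ?thesis unfolding R
      using abs_of_multiple[OF d1(1) lo_pos(3) d1(2)]
        abs_of_multiple[OF d2(1) lo_pos(2) less_imp_le[OF d2(2)]] d1 d2
      by (intro exI[of _ d2] exI[of _ d1]) simp
  qed

  show ?thesis unfolding eps using norm exact same opposite by blast
qed

end
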